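(* Let $G$ be a finite simple graph on $n$ vertices with independence number $\alpha(G)=2$. If $G$ has a dominating edge $uv$ such that the graph $G\setminus\{u,v\}$ has diameter $3$, then $ecc(G)\leq n$.
   Context: The edge clique cover number $ecc(G)$ is the minimum number of cliques (vertex subsets inducing complete subgraphs) of $G$ such that both endpoints of every edge of $G$ lie together in at least one of these cliques. An edge $uv$ of $G$ is a dominating edge if every vertex of $G$ other than $u,v$ is adjacent to at least one of $u$ and $v$. $G\setminus\{u,v\}$ denotes the subgraph induced by the vertices other than $u$ and $v$. *)

theory Defs
  imports "Graph_Theory.Graph_Theory"
begin

text \<open>
  A finite simple graph is a \<^locale>\<open>graph\<close> (finite, symmetric, no loops, no parallel arcs);
  an undirected edge is a pair of opposite arcs, and adjacency is \<open>x \<rightarrow>\<^bsub>G\<^esub> y\<close>.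
\<close>

definition independent_set :: "('a, 'b) pre_digraph \<Rightarrow> 'a set \<Rightarrow> bool" where
  "independent_set G S \<longleftrightarrow> S \<subseteq> verts G \<and> (\<forall>x\<in>S. \<forall>y\<in>S. \<not> x \<rightarrow>\<^bsub>G\<^esub> y)"

definition independence_number :: "('a, 'b) pre_digraph \<Rightarrow> nat" where
  "independence_number G = Max (card ` {S. independent_set G S})"

definition clique :: "('a, 'b) pre_digraph \<Rightarrow> 'a set \<Rightarrow> bool" where
  "clique G C \<longleftrightarrow> C \<subseteq> verts G \<and> K\<^bsub>card C\<^esub> (G \<restriction> C)"

lemma (in graph) clique_iff:
  "clique G C \<longleftrightarrow> C \<subseteq> verts G \<and> (\<forall>x\<in>C. \<forall>y\<in>C. x \<noteq> y \<longrightarrow> x \<rightarrow>\<^bsub>G\<^esub> y)"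
proof (cases "C \<subseteq> verts G")
  case True
  then have H: "digraph (G \<restriction> C)"
    by (intro digraphI_induced induced_induce)
  have E: "arcs_ends (G \<restriction> C) = {(x, y). x \<in> C \<and> y \<in> C \<and> x \<rightarrow>\<^bsub>G\<^esub> y}"
    by (auto simp: arcs_ends_conv)
  have "sym (arcs_ends G)"
    using sym_arcs by (simp add: symmetric_def)
  then have "graph (G \<restriction> C)"
    by (intro digraph.graphI[OF H]) (auto simp: symmetric_def E sym_def)
  moreover have "x \<noteq> y" if "x \<rightarrow>\<^bsub>G\<^esub> y" for x y
    using that no_loops by (auto simp: arcs_ends_conv)
  ultimately show ?thesis
    using True by (simp add: clique_def complete_digraph_def E set_eq_iff) blast
qed (simp add: clique_def)

definition edge_clique_cover :: "('a, 'b) pre_digraph \<Rightarrow> 'a set set \<Rightarrow> bool" where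
  "edge_clique_cover G F \<longleftrightarrow>
     (\<forall>C\<in>F. clique G C) \<and> (\<forall>x y. x \<rightarrow>\<^bsub>G\<^esub> y \<longrightarrow> (\<exists>C\<in>F. x \<in> C \<and> y \<in> C))"

definition ecc :: "('a, 'b) pre_digraph \<Rightarrow> nat" where
  "ecc G = (LEAST k. \<exists>F. finite F \<and> card F = k \<and> edge_clique_cover G F)"

definition dominating_edge :: "('a, 'b) pre_digraph \<Rightarrow> 'a \<Rightarrow> 'a \<Rightarrow> bool" where
  "dominating_edge G u v \<longleftrightarrow>
     u \<rightarrow>\<^bsub>G\<^esub> v \<and> (\<forall>w\<in>verts G - {u, v}. w \<rightarrow>\<^bsub>G\<^esub> u \<or> w \<rightarrow>\<^bsub>G\<^esub> v)"

text \<open>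
  With unit arc weights, \<^const>\<open>wf_digraph.\<mu>\<close> is the length of a shortest walk, and
  \<open>\<infinity>\<close> if there is none; so the diameter of a disconnected graph is \<open>\<infinity>\<close>.
\<close>

definition diameter :: "('a, 'b) pre_digraph \<Rightarrow> ereal" where
  "diameter G = (SUP x\<in>verts G. SUP y\<in>verts G. wf_digraph.\<mu> G (\<lambda>_. 1) x y)"

end

theory Submission
  imports Defs
begin

text \<open>
  Let \<open>a\<close>, \<open>b\<close> be vertices at distance at least 3 in \<open>G \ {u, v}\<close>. Since there is no independent
  triple, the closed neighbourhoods \<open>A\<close> of \<open>a\<close> and \<open>B\<close> of \<open>b\<close> in this graph are disjoint cliques
  that exhaust it. Write \<open>N z\<close> for the vertices of \<open>A \<union> B\<close> not adjacent to \<open>z\<close>, and \<open>W\<close> for the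
  common neighbours of \<open>u\<close> and \<open>v\<close>. The six cliques \<open>A\<close>, \<open>B\<close>, \<open>{u, v} \<union> (W \<inter> A)\<close>,
  \<open>{u, v} \<union> (W \<inter> B)\<close>, \<open>{u} \<union> N v\<close>, \<open>{v} \<union> N u\<close> cover every edge not joining \<open>A\<close> to \<open>B\<close>, and the
  latter are covered by the \<open>|A| - 1\<close> stars \<open>{x} \<union> (\<Gamma>(x) \<inter> B)\<close> with \<open>x \<in> A - {a}\<close>. This gives
  \<open>|A| + 5\<close> cliques, and symmetrically \<open>|B| + 5\<close>, which is enough unless \<open>|A| = |B| = 2\<close>. In that
  case one of the seven cliques is redundant after possibly enlarging \<open>A\<close> or \<open>B\<close> by \<open>v\<close>.
\<close>

section \<open>Distances and independent sets\<close>

text \<open>Some distance exceeds 2, since otherwise the supremum would be at most 2, and it is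
  finite. Excluding walks of length 0, 1 and 2 separates \<open>a\<close> from \<open>b\<close>; the
  first and last arcs of an existing walk give \<open>x\<close> and \<open>y\<close>, which later
  put two vertices into each part.\<close>

lemma (in wf_digraph) diameter_eq_3E:
  assumes "diameter G = 3"
  obtains a b x y where "a \<in> verts G" "b \<in> verts G" "a \<noteq> b" "\<not> a \<rightarrow>\<^bsub>G\<^esub> b"
    "\<And>c. a \<rightarrow>\<^bsub>G\<^esub> c \<Longrightarrow> \<not> c \<rightarrow>\<^bsub>G\<^esub> b" "a \<rightarrow>\<^bsub>G\<^esub> x" "y \<rightarrow>\<^bsub>G\<^esub> b"
proof -
  have "\<exists>a\<in>verts G. \<exists>b\<in>verts G. 2 < \<mu> (\<lambda>_. 1) a b"
  proof (rule ccontr)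
    assume "\<not> ?thesis"
    then have "diameter G \<le> 2"
      unfolding diameter_def by (intro SUP_least) (auto simp: not_less)
    with assms show False by simp
  qed
  then obtain a b where ab: "a \<in> verts G" "b \<in> verts G" and far: "2 < \<mu> (\<lambda>_. 1) a b"
    by blast
  have "\<mu> (\<lambda>_. 1) a b \<le> diameter G"
    unfolding diameter_def using ab by (meson SUP_upper2 order_refl)
  then have "\<mu> (\<lambda>_. 1) a b \<noteq> \<infinity>"
    using assms by auto
  then have reach: "a \<rightarrow>\<^sup>* b"
    using shortest_path_inf by blast
  have long: "2 < length p" if "awalk a p b" for p
  proof -
    have "2 < ereal (awalk_cost (\<lambda>_. 1) p)"
      using far min_cost_le_walk_cost[OF that] by (rule less_le_trans)
    also have "awalk_cost (\<lambda>_. 1) p = real (length p)"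
      by (induction p) auto
    finally show ?thesis by simp
  qed
  have "a \<noteq> b"
    using long[of "[]"] ab by (auto simp: awalk_simps)
  moreover have "\<not> a \<rightarrow>\<^bsub>G\<^esub> b"
    using long[of "[e]" for e] ab by (fastforce simp: awalk_simps arcs_ends_conv)
  moreover have "\<not> c \<rightarrow>\<^bsub>G\<^esub> b" if "a \<rightarrow>\<^bsub>G\<^esub> c" for c
    using that long[of "[e, f]" for e f] ab by (fastforce simp: awalk_simps arcs_ends_conv)
  moreover obtain x where "a \<rightarrow>\<^bsub>G\<^esub> x"
    using reach \<open>a \<noteq> b\<close> by (meson converse_reachable_cases)
  moreover obtain y where "y \<rightarrow>\<^bsub>G\<^esub> b"
    using reach \<open>a \<noteq> b\<close> unfolding reachable_def by (cases rule: rtrancl_on.cases) auto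
  ultimately show ?thesis
    using that ab by blast
qed

lemma (in graph) card_independent_le:
  assumes "independent_set G S"
  shows "card S \<le> independence_number G"
proof -
  have "{S. independent_set G S} \<subseteq> Pow (verts G)"
    by (auto simp: independent_set_def)
  then have "finite {S. independent_set G S}"
    by (rule finite_subset) simp
  then show ?thesis
    unfolding independence_number_def using assms by (intro Max_ge) auto
qed

lemma (in graph) ecc_le_card:
  assumes "finite F" "edge_clique_cover G F"
  shows "ecc G \<le> card F"
  unfolding ecc_def using assms by (intro Least_le) blast

text \<open>Lets a clique be discarded once it lies in another one or in an enlargement of another
  one.\<close>

lemma edge_clique_cover_refine:
  assumes "edge_clique_cover G F" "\<And>C. C \<in> F \<Longrightarrow> \<exists>D\<in>F'. C \<subseteq> D"
    "\<And>D. D \<in> F' \<Longrightarrow> clique G D"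
  shows "edge_clique_cover G F'"
  using assms unfolding edge_clique_cover_def by (meson subsetD)

section \<open>Two cliques and a dominating edge\<close>

text \<open>The vertices \<open>a\<close> and \<open>b\<close> stay outside the locale, which makes
  it symmetric in \<open>A\<close> and \<open>B\<close>: each bound transfers by exchanging the
  parts.\<close>

locale cobipartite_dominating_edge = graph G for G :: "('a, 'b) pre_digraph" (structure) +
  fixes A B :: "'a set" and u v :: 'a
  assumes verts_eq: "verts G = A \<union> B \<union> {u, v}"
    and A_B_disjoint: "A \<inter> B = {}"
    and uv_notin: "u \<notin> A \<union> B" "v \<notin> A \<union> B"
    and clique_A: "clique G A"
    and clique_B: "clique G B"
    and edge_uv: "u \<rightarrow>\<^bsub>G\<^esub> v"
    and dominating: "w \<in> A \<union> B \<Longrightarrow> w \<rightarrow>\<^bsub>G\<^esub> u \<or> w \<rightarrow>\<^bsub>G\<^esub> v"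
    and no_independent_triple: "\<lbrakk>x \<in> verts G; y \<in> verts G; z \<in> verts G; x \<noteq> y; y \<noteq> z; x \<noteq> z\<rbrakk>
      \<Longrightarrow> x \<rightarrow>\<^bsub>G\<^esub> y \<or> y \<rightarrow>\<^bsub>G\<^esub> z \<or> x \<rightarrow>\<^bsub>G\<^esub> z"
begin

lemma adj_commute: "x \<rightarrow>\<^bsub>G\<^esub> y \<longleftrightarrow> y \<rightarrow>\<^bsub>G\<^esub> x"
  using sym_arcs by (auto simp: symmetric_def sym_def)

lemma swap_parts: "cobipartite_dominating_edge G B A u v"
  by unfold_locales
    (use verts_eq A_B_disjoint uv_notin clique_A clique_B edge_uv dominating
      no_independent_triple in auto)

section \<open>Base cliques and stars\<close>

definition nonnbrs :: "'a \<Rightarrow> 'a set" where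
  "nonnbrs z = {w \<in> A \<union> B. \<not> w \<rightarrow>\<^bsub>G\<^esub> z}"

definition common :: "'a set" where
  "common = {w \<in> A \<union> B. w \<rightarrow>\<^bsub>G\<^esub> u \<and> w \<rightarrow>\<^bsub>G\<^esub> v}"

definition base :: "'a set set" where
  "base = {A, B, {u, v} \<union> (common \<inter> A), {u, v} \<union> (common \<inter> B), {u} \<union> nonnbrs v, {v} \<union> nonnbrs u}"

definition star :: "'a \<Rightarrow> 'a set" where
  "star x = insert x {y \<in> B. x \<rightarrow>\<^bsub>G\<^esub> y}"

lemma finite_parts: "finite A" "finite B"
  using finite_verts by (auto simp: verts_eq)

lemma uv_neq: "u \<noteq> v"
  using edge_uv adj_not_same by blast

lemma adj_A: "x \<in> A \<Longrightarrow> y \<in> A \<Longrightarrow> x \<noteq> y \<Longrightarrow> x \<rightarrow>\<^bsub>G\<^esub> y"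
  and adj_B: "x \<in> B \<Longrightarrow> y \<in> B \<Longrightarrow> x \<noteq> y \<Longrightarrow> x \<rightarrow>\<^bsub>G\<^esub> y"
  using clique_A clique_B by (auto simp: clique_iff)

text \<open>Two nonadjacent nonneighbours of \<open>z\<close> would form an independent triple with
  it.\<close>

lemma clique_nonnbrs:
  assumes "x \<in> nonnbrs z" "y \<in> nonnbrs z" "x \<noteq> y" "z \<in> {u, v}"
  shows "x \<rightarrow>\<^bsub>G\<^esub> y"
  using no_independent_triple[of x y z] assms uv_notin by (auto simp: nonnbrs_def verts_eq)

lemma clique_base: "C \<in> base \<Longrightarrow> clique G C"
proof -
  have "clique G ({u, v} \<union> (common \<inter> A))"
    using adj_A edge_uv adj_commute unfolding clique_iff verts_eq common_def by blast
  moreover have "clique G ({u, v} \<union> (common \<inter> B))"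
    using adj_B edge_uv adj_commute unfolding clique_iff verts_eq common_def by blast
  \<comment> \<open>Since the edge is dominating, \<open>u\<close> is adjacent to every nonneighbour
    of \<open>v\<close>.\<close>
  moreover have "clique G ({u} \<union> nonnbrs v)"
    using clique_nonnbrs dominating adj_commute unfolding clique_iff verts_eq nonnbrs_def by blast
  moreover have "clique G ({v} \<union> nonnbrs u)"
    using clique_nonnbrs dominating adj_commute unfolding clique_iff verts_eq nonnbrs_def by blast
  ultimately show "C \<in> base \<Longrightarrow> clique G C"
    using clique_A clique_B by (auto simp: base_def)
qed

lemma clique_star: "x \<in> A \<Longrightarrow> clique G (star x)"
  unfolding clique_iff verts_eq star_def using adj_B adj_commute by blast

text \<open>A neighbour of \<open>u\<close> in either part is also adjacent to \<open>v\<close>,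
  hence in \<open>common\<close>, or it lies in \<open>nonnbrs v\<close>; the same holds with
  \<open>u\<close> and \<open>v\<close> exchanged.\<close>

lemma base_covers:
  assumes "x \<rightarrow>\<^bsub>G\<^esub> y" "\<not> (x \<in> A \<and> y \<in> B)" "\<not> (x \<in> B \<and> y \<in> A)"
  shows "\<exists>C\<in>base. x \<in> C \<and> y \<in> C"
proof -
  have u: "\<exists>C\<in>base. u \<in> C \<and> w \<in> C" if "u \<rightarrow>\<^bsub>G\<^esub> w" for w
  proof -
    have "w \<in> A \<union> B \<union> {u, v}"
      using that adj_in_verts(2) verts_eq by blast
    then show ?thesis
      using that adj_commute by (auto simp: base_def common_def nonnbrs_def)
  qed
  have v: "\<exists>C\<in>base. v \<in> C \<and> w \<in> C" if "v \<rightarrow>\<^bsub>G\<^esub> w" for w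
  proof -
    have "w \<in> A \<union> B \<union> {u, v}"
      using that adj_in_verts(2) verts_eq by blast
    then show ?thesis
      using that adj_commute by (auto simp: base_def common_def nonnbrs_def)
  qed
  have "x \<in> A \<union> B \<union> {u, v}" "y \<in> A \<union> B \<union> {u, v}"
    using adj_in_verts[OF assms(1)] verts_eq by auto
  then consider "x = u" | "x = v" | "y = u" | "y = v" | "x \<in> A" "y \<in> A" | "x \<in> B" "y \<in> B"
    using assms(2,3) by blast
  moreover have "y \<rightarrow>\<^bsub>G\<^esub> x"
    using assms(1) adj_commute by simp
  ultimately show ?thesis
    using u v assms(1) by cases (auto simp: base_def)
qed

text \<open>A crossing edge lies in the star of its end in \<open>A\<close>, and this end is never
  \<open>a\<close>.\<close>

lemma edge_clique_cover_base_stars: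
  assumes "a \<in> A" "\<And>y. y \<in> B \<Longrightarrow> \<not> a \<rightarrow>\<^bsub>G\<^esub> y"
  shows "edge_clique_cover G (base \<union> star ` (A - {a}))"
  unfolding edge_clique_cover_def
proof (intro conjI ballI allI impI)
  fix C assume "C \<in> base \<union> star ` (A - {a})"
  then show "clique G C"
    using clique_base clique_star by auto
next
  fix x y assume xy: "x \<rightarrow>\<^bsub>G\<^esub> y"
  have cross: "\<exists>C\<in>star ` (A - {a}). x \<in> C \<and> y \<in> C" if "x \<rightarrow>\<^bsub>G\<^esub> y" "x \<in> A" "y \<in> B" for x y
    using that assms by (auto simp: star_def)
  show "\<exists>C\<in>base \<union> star ` (A - {a}). x \<in> C \<and> y \<in> C"
    using base_covers[OF xy] cross[of x y] cross[of y x] xy adj_commute by blast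
qed

section \<open>Counting the cliques\<close>

lemma card_base_le: "card base \<le> 6"
  using card_length[of "[A, B, {u, v} \<union> (common \<inter> A), {u, v} \<union> (common \<inter> B),
    {u} \<union> nonnbrs v, {v} \<union> nonnbrs u]"] by (simp add: base_def)

lemma ecc_le_card_part:
  assumes "a \<in> A" "\<And>y. y \<in> B \<Longrightarrow> \<not> a \<rightarrow>\<^bsub>G\<^esub> y"
  shows "ecc G \<le> card A + 5"
proof -
  have "ecc G \<le> card (base \<union> star ` (A - {a}))"
    by (intro ecc_le_card edge_clique_cover_base_stars assms) (auto simp: base_def finite_parts)
  also have "\<dots> \<le> card base + card (star ` (A - {a}))"
    by (rule card_Un_le)
  also have "\<dots> \<le> 6 + (card A - 1)"
    using card_base_le card_image_le[of "A - {a}" star] finite_parts assms(1)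
    by (intro add_mono) auto
  \<comment> \<open>Subtraction is truncated, so \<open>a\<close> has to witness that
    \<open>card A\<close> is positive.\<close>
  also have "\<dots> = card A + 5"
  proof -
    have "card A > 0"
      using assms(1) finite_parts card_gt_0_iff by blast
    then show ?thesis by simp
  qed
  finally show ?thesis .
qed

text \<open>The only star is \<open>star x\<close>, so there are seven cliques and one must be
  saved.\<close>

lemma ecc_le_6:
  assumes A: "A = {a, x}" "a \<noteq> x" and B: "B = {b, y}" "b \<noteq> y"
    and a: "\<And>y. y \<in> B \<Longrightarrow> \<not> a \<rightarrow>\<^bsub>G\<^esub> y"
  shows "ecc G \<le> 6"
proof -
  have cover: "edge_clique_cover G (insert (star x) base)"
    using edge_clique_cover_base_stars[OF _ a] A by (simp add: insert_Diff_if)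
  have cliques: "clique G D" if "D \<in> insert (star x) base" for D
    using cover that by (auto simp: edge_clique_cover_def)
  \<comment> \<open>It suffices to list at most six cliques such that each of the seven lies in one
    of them.\<close>
  have bound: "ecc G \<le> 6"
    if "length Ds \<le> 6" "\<forall>D\<in>set Ds. clique G D" "\<forall>C\<in>insert (star x) base. \<exists>D\<in>set Ds. C \<subseteq> D"
    for Ds
  proof -
    have "edge_clique_cover G (set Ds)"
      using edge_clique_cover_refine[OF cover] that(2,3) by blast
    then have "ecc G \<le> card (set Ds)"
      by (intro ecc_le_card) auto
    also have "\<dots> \<le> 6"
      using card_length that(1) by (rule order_trans)
    finally show ?thesis .
  qed
  let ?WA = "{u, v} \<union> (common \<inter> A)" and ?WB = "{u, v} \<union> (common \<inter> B)"
    and ?U = "{u} \<union> nonnbrs v" and ?V = "{v} \<union> nonnbrs u"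
  \<comment> \<open>By domination \<open>nonnbrs u\<close> and \<open>nonnbrs v\<close> are
    disjoint. If the first four cases fail, each part has a common neighbour and so at most one
    other vertex; the two nonempty sets then lie in different parts.\<close>
  consider "nonnbrs u = {}" | "nonnbrs v = {}" | "common \<inter> A = {}" | "common \<inter> B = {}"
    | "nonnbrs u \<subseteq> A" "nonnbrs v \<subseteq> B" | "nonnbrs u \<subseteq> B" "nonnbrs v \<subseteq> A"
    unfolding nonnbrs_def common_def using A B dominating by auto
  then show ?thesis
  proof cases
    \<comment> \<open>In cases 1 and 2 the dropped clique is a singleton, in cases 3 and 4 it is
      \<open>{u, v}\<close>; each lies in a remaining clique.\<close>
    case 1
    show ?thesis
      by (rule bound[of "[star x, A, B, ?WA, ?WB, ?U]"]) (use 1 cliques in \<open>auto simp: base_def\<close>)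
  next
    case 2
    show ?thesis
      by (rule bound[of "[star x, A, B, ?WA, ?WB, ?V]"]) (use 2 cliques in \<open>auto simp: base_def\<close>)
  next
    case 3
    show ?thesis
      by (rule bound[of "[star x, A, B, ?WB, ?U, ?V]"]) (use 3 cliques in \<open>auto simp: base_def\<close>)
  next
    case 4
    show ?thesis
      by (rule bound[of "[star x, A, B, ?WA, ?U, ?V]"]) (use 4 cliques in \<open>auto simp: base_def\<close>)
  next
    case 5
    \<comment> \<open>As \<open>nonnbrs v\<close> misses \<open>A\<close>, the vertex
      \<open>v\<close> is adjacent to all of \<open>A\<close>; the enlarged clique absorbs both
      \<open>A\<close> and \<open>?V\<close>.\<close>
    have "clique G (insert v A)"
      using 5 A_B_disjoint adj_A adj_commute
      unfolding clique_iff verts_eq nonnbrs_def by blast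
    then show ?thesis
      by (intro bound[of "[star x, insert v A, B, ?WA, ?WB, ?U]"])
        (use 5 cliques in \<open>auto simp: base_def\<close>)
  next
    case 6
    have "clique G (insert v B)"
      using 6 A_B_disjoint adj_B adj_commute
      unfolding clique_iff verts_eq nonnbrs_def by blast
    then show ?thesis
      by (intro bound[of "[star x, A, insert v B, ?WA, ?WB, ?U]"])
        (use 6 cliques in \<open>auto simp: base_def\<close>)
  qed
qed

lemma ecc_le_card_verts:
  assumes a: "a \<in> A" "\<And>y. y \<in> B \<Longrightarrow> \<not> a \<rightarrow>\<^bsub>G\<^esub> y"
    and b: "b \<in> B" "\<And>x. x \<in> A \<Longrightarrow> \<not> x \<rightarrow>\<^bsub>G\<^esub> b"
    and ge2: "2 \<le> card A" "2 \<le> card B"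
  shows "ecc G \<le> card (verts G)"
proof -
  have card: "card (verts G) = card A + card B + 2"
    using A_B_disjoint uv_notin uv_neq finite_parts
    by (simp add: verts_eq card_Un_disjoint)
  interpret swap: cobipartite_dominating_edge G B A u v
    by (rule swap_parts)
  \<comment> \<open>The bound \<open>card A + 5\<close> is at most
    \<open>card A + card B + 2\<close> exactly when \<open>card B\<close> is at least 3. If both
    parts have size 2, the graph has six vertices.\<close>
  consider "3 \<le> card B" | "3 \<le> card A" | "card A = 2" "card B = 2"
    using ge2 by linarith
  then show ?thesis
  proof cases
    case 1
    then show ?thesis using ecc_le_card_part[OF a] card by simp
  next
    case 2
    have "\<not> b \<rightarrow>\<^bsub>G\<^esub> x" if "x \<in> A" for x
      using b(2)[OF that] adj_commute by blast
    with 2 show ?thesis using swap.ecc_le_card_part[OF b(1)] card by fastforce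
  next
    case 3
    obtain x where "A = {a, x}" "a \<noteq> x"
      using 3(1) a(1) by (auto simp: card_2_iff)
    moreover obtain y where "B = {b, y}" "b \<noteq> y"
      using 3(2) b(1) by (auto simp: card_2_iff)
    ultimately have "ecc G \<le> 6"
      using ecc_le_6 a(2) by blast
    then show ?thesis using card 3 by simp
  qed
qed

end

section \<open>From the diameter condition to two cliques\<close>

theorem theorem4:
  fixes G :: "('a, 'b) pre_digraph" and n :: nat and u v :: 'a
  assumes "graph G"
    and "card (verts G) = n"
    and "independence_number G = 2"
    and "dominating_edge G u v"
    and "diameter (G \<restriction> (verts G - {u, v})) = 3"
  shows "ecc G \<le> n"
proof -
  interpret graph G by fact
  let ?S = "verts G - {u, v}"
  interpret H: digraph "G \<restriction> ?S"
    by (intro digraphI_induced induced_induce) auto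
  have H_adj: "x \<rightarrow>\<^bsub>G \<restriction> ?S\<^esub> y \<longleftrightarrow> x \<in> ?S \<and> y \<in> ?S \<and> x \<rightarrow>\<^bsub>G\<^esub> y" for x y
    by (auto simp: arcs_ends_conv)
  have comm: "x \<rightarrow>\<^bsub>G\<^esub> y \<longleftrightarrow> y \<rightarrow>\<^bsub>G\<^esub> x" for x y
    using sym_arcs by (auto simp: symmetric_def sym_def)
  have triple: "x \<rightarrow>\<^bsub>G\<^esub> y \<or> y \<rightarrow>\<^bsub>G\<^esub> z \<or> x \<rightarrow>\<^bsub>G\<^esub> z"
    if "x \<in> verts G" "y \<in> verts G" "z \<in> verts G" "x \<noteq> y" "y \<noteq> z" "x \<noteq> z" for x y z
  proof (rule ccontr)
    assume "\<not> ?thesis"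
    then have "independent_set G {x, y, z}"
      using that comm adj_not_same by (auto simp: independent_set_def)
    then show False
      using card_independent_le assms(3) that by fastforce
  qed
  obtain a b x y where far: "a \<in> verts (G \<restriction> ?S)" "b \<in> verts (G \<restriction> ?S)" "a \<noteq> b" "\<not> a \<rightarrow>\<^bsub>G \<restriction> ?S\<^esub> b"
    "\<And>c. a \<rightarrow>\<^bsub>G \<restriction> ?S\<^esub> c \<Longrightarrow> \<not> c \<rightarrow>\<^bsub>G \<restriction> ?S\<^esub> b" "a \<rightarrow>\<^bsub>G \<restriction> ?S\<^esub> x" "y \<rightarrow>\<^bsub>G \<restriction> ?S\<^esub> b"
    by (rule H.diameter_eq_3E[OF assms(5)]) blast
  have ab: "a \<in> ?S" "b \<in> ?S" "a \<noteq> b" "\<not> a \<rightarrow>\<^bsub>G\<^esub> b"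
    using far(1-4) unfolding H_adj induce_subgraph_verts by blast+
  have no_common: "\<not> c \<rightarrow>\<^bsub>G\<^esub> b" if "c \<in> ?S" "a \<rightarrow>\<^bsub>G\<^esub> c" for c
    using far(5) that ab unfolding H_adj by blast
  have x: "x \<in> ?S" "a \<rightarrow>\<^bsub>G\<^esub> x" and y: "y \<in> ?S" "y \<rightarrow>\<^bsub>G\<^esub> b"
    using far(6,7) unfolding H_adj by blast+
  define A where "A = {w \<in> ?S. w = a \<or> w \<rightarrow>\<^bsub>G\<^esub> a}"
  define B where "B = {w \<in> ?S. w = b \<or> w \<rightarrow>\<^bsub>G\<^esub> b}"
  have mem: "a \<in> A" "b \<in> B" "x \<in> A" "y \<in> B"
    using ab x y comm by (auto simp: A_def B_def)
  have disjoint: "A \<inter> B = {}"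
    using ab no_common comm by (auto simp: A_def B_def)
  \<comment> \<open>A further vertex adjacent to neither \<open>a\<close> nor \<open>b\<close> would
    complete an independent triple.\<close>
  have union: "A \<union> B = ?S"
    using triple[of a b] ab comm by (fastforce simp: A_def B_def)
  have a: "\<not> a \<rightarrow>\<^bsub>G\<^esub> w" if "w \<in> B" for w
    using that disjoint union comm by (auto simp: A_def)
  have b: "\<not> w \<rightarrow>\<^bsub>G\<^esub> b" if "w \<in> A" for w
    using that disjoint union by (auto simp: B_def)
  have uv: "u \<rightarrow>\<^bsub>G\<^esub> v" "\<And>w. w \<in> ?S \<Longrightarrow> w \<rightarrow>\<^bsub>G\<^esub> u \<or> w \<rightarrow>\<^bsub>G\<^esub> v"
    using assms(4) by (auto simp: dominating_edge_def)
  interpret cobipartite_dominating_edge G A B u v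
  proof unfold_locales
    show "verts G = A \<union> B \<union> {u, v}"
      using adj_in_verts[OF uv(1)] union by blast
    show "u \<notin> A \<union> B" "v \<notin> A \<union> B"
      using union by auto
    \<comment> \<open>No vertex of \<open>A\<close> is adjacent to \<open>b\<close>, so two
      nonadjacent ones would form an independent triple with \<open>b\<close>. For \<open>B\<close>
      the third vertex is \<open>a\<close>.\<close>
    show "clique G A"
      unfolding clique_iff
    proof (intro conjI ballI impI)
      show "A \<subseteq> verts G" using union by blast
    next
      fix w z assume "w \<in> A" "z \<in> A" "w \<noteq> z"
      moreover have "\<not> w \<rightarrow>\<^bsub>G\<^esub> b" "\<not> z \<rightarrow>\<^bsub>G\<^esub> b"
        using b \<open>w \<in> A\<close> \<open>z \<in> A\<close> by auto
      moreover have "w \<noteq> b" "z \<noteq> b"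
        using \<open>w \<in> A\<close> \<open>z \<in> A\<close> mem disjoint by auto
      moreover have "w \<in> verts G" "z \<in> verts G" "b \<in> verts G"
        using \<open>w \<in> A\<close> \<open>z \<in> A\<close> mem union by auto
      ultimately show "w \<rightarrow>\<^bsub>G\<^esub> z"
        using triple[of w z b] by blast
    qed
    show "clique G B"
      unfolding clique_iff
    proof (intro conjI ballI impI)
      show "B \<subseteq> verts G" using union by blast
    next
      fix w z assume "w \<in> B" "z \<in> B" "w \<noteq> z"
      moreover have "\<not> a \<rightarrow>\<^bsub>G\<^esub> w" "\<not> a \<rightarrow>\<^bsub>G\<^esub> z"
        using a \<open>w \<in> B\<close> \<open>z \<in> B\<close> by auto
      moreover have "a \<noteq> w" "a \<noteq> z"
        using \<open>w \<in> B\<close> \<open>z \<in> B\<close> mem disjoint by auto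
      moreover have "w \<in> verts G" "z \<in> verts G" "a \<in> verts G"
        using \<open>w \<in> B\<close> \<open>z \<in> B\<close> mem union by auto
      ultimately show "w \<rightarrow>\<^bsub>G\<^esub> z"
        using triple[of a w z] by blast
    qed
  qed (use disjoint uv union triple in auto)
  have "a \<noteq> x" "b \<noteq> y"
    using x y adj_not_same by auto
  then have "2 \<le> card A" "2 \<le> card B"
    using card_mono[OF finite_parts(1), of "{a, x}"] card_mono[OF finite_parts(2), of "{b, y}"] mem
    by auto
  then show ?thesis
    using ecc_le_card_verts[OF mem(1) a mem(2) b] assms(2) by simp
qed

end
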